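(* $B_\lambda$ is a $\mathbb Z$-basis of $\mathbb Z[\hat h_k\mid k>0]$ (thus $\mathbb Z[\hat h_k\mid k>0]=\mathbb Z_\lambda[h_r\mid r>0]$).
   Context: $\mathbb N=\{0,1,\dots\}$, $\mathbb Z_+=\{1,2,\dots\}$. In the polynomial algebra $\mathbb Q[h_r\mid r>0]$ the elements $\hat h_k$ are defined by $\sum_{k\ge0}\hat h_ku^k=\exp\big(\sum_{r>0}(-1)^{r-1}\frac{h_r}{r}u^r\big)$, and $\mathbb Z[\hat h_k\mid k>0]$ is the $\mathbb Z$-subalgebra they generate. For $m>0$, $\lambda_m$ is the algebra endomorphism of $\mathbb Q[h_r\mid r>0]$ with $\lambda_m(h_r)=h_{mr}$ for all $r>0$. For ${\bf k}:\mathbb Z_+\to\mathbb N$ finitely supported put $b_{\bf k}=\prod_{m>0}\lambda_m(\hat h_{k_m})$; $B_\lambda=\{b_{\bf k}\mid{\bf k}:\mathbb Z_+\to\mathbb N\text{ finitely supported}\}$; $\mathbb Z_\lambda[h_r\mid r>0]=\sum_{\bf k}\mathbb Zb_{\bf k}$ is the $\mathbb Z$-submodule of $\mathbb Q[h_r\mid r>0]$ generated by $B_\lambda$. *)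

theory Defs
  imports
    "HOL-Library.Poly_Mapping"
    "HOL-Computational_Algebra.Formal_Power_Series"
begin

text \<open>
  The polynomial algebra \<open>Q[h_r | r > 0]\<close> is realised as the monoid algebra over the rationals
  of the monoid of finitely supported exponent vectors. Its variables are numbered from \<open>0\<close>,
  and \<open>hgen r\<close> represents \<open>h_r\<close> as the variable with number \<open>r - 1\<close>. Thus \<open>h_1, h_2, ...\<close> are
  exactly all variables, and \<open>hgen 0\<close> is a junk value that is never used.
\<close>

type_synonym hpoly = "(nat \<Rightarrow>\<^sub>0 nat) \<Rightarrow>\<^sub>0 rat"

definition const :: "rat \<Rightarrow> hpoly" where
  "const c = Poly_Mapping.single 0 c"

definition hgen :: "nat \<Rightarrow> hpoly" where
  "hgen r = Poly_Mapping.single (Poly_Mapping.single (r - 1) 1) 1"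

text \<open>
  \<open>exp F\<close> is the substitution of \<open>F\<close>, which must have zero constant term, into the
  exponential series. The library constant \<open>fps_exp\<close> is not applicable since it divides in
  the coefficient ring.
\<close>

definition exp_fps :: "hpoly fps \<Rightarrow> hpoly fps" where
  "exp_fps F = fps_compose (Abs_fps (\<lambda>n. const (1 / fact n))) F"

definition hhat :: "nat \<Rightarrow> hpoly" where
  "hhat k = fps_nth (exp_fps (Abs_fps (\<lambda>r. if r = 0 then 0
                                 else const ((-1) ^ (r - 1) / of_nat r) * hgen r))) k"

lemma hhat_gf:
  "Abs_fps hhat = exp_fps (Abs_fps (\<lambda>r. if r = 0 then 0
                             else const ((-1) ^ (r - 1) / of_nat r) * hgen r))"
  by (rule fps_ext) (simp add: hhat_def)

definition hsubst :: "(nat \<Rightarrow> hpoly) \<Rightarrow> hpoly \<Rightarrow> hpoly" where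
  "hsubst f p = (\<Sum>t\<in>Poly_Mapping.keys p. const (Poly_Mapping.lookup p t) *
      (\<Prod>i\<in>Poly_Mapping.keys t. f i ^ Poly_Mapping.lookup t i))"

text \<open>The variable with number \<open>i\<close> is \<open>hgen (i + 1)\<close>, so it is sent to \<open>hgen (m * (i + 1))\<close>.\<close>

definition lam :: "nat \<Rightarrow> hpoly \<Rightarrow> hpoly" where
  "lam m = hsubst (\<lambda>i. hgen (m * (i + 1)))"

lemma const_0 [simp]: "const 0 = 0"
  and const_1 [simp]: "const 1 = 1"
  and const_add: "const (a + b) = const a + const b"
  and const_mult: "const (a * b) = const a * const b"
  by (simp_all add: const_def single_add mult_single)

lemma hsubst_superset:
  assumes "finite A" "Poly_Mapping.keys p \<subseteq> A"
  shows "hsubst f p = (\<Sum>t\<in>A. const (Poly_Mapping.lookup p t) *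
           (\<Prod>i\<in>Poly_Mapping.keys t. f i ^ Poly_Mapping.lookup t i))"
  unfolding hsubst_def using assms
  by (intro sum.mono_neutral_left) (auto simp: in_keys_iff)

lemma hsubst_add: "hsubst f (p + q) = hsubst f p + hsubst f q"
proof -
  let ?A = "Poly_Mapping.keys p \<union> Poly_Mapping.keys q"
  have "Poly_Mapping.keys (p + q) \<subseteq> ?A" by (rule Poly_Mapping.keys_add)
  then show ?thesis
    by (simp add: hsubst_superset[of ?A] lookup_add const_add distrib_right sum.distrib)
qed

lemma hsubst_zero: "hsubst f 0 = 0"
  by (simp add: hsubst_def)

lemma hsubst_sum: "hsubst f (sum g A) = (\<Sum>x\<in>A. hsubst f (g x))"
  by (induction A rule: infinite_finite_induct) (simp_all add: hsubst_zero hsubst_add)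

lemma hsubst_single:
  "hsubst f (Poly_Mapping.single t c) =
     const c * (\<Prod>i\<in>Poly_Mapping.keys t. f i ^ Poly_Mapping.lookup t i)"
  by (cases "c = 0") (simp_all add: hsubst_def)

lemma monomial_image_add:
  fixes f :: "nat \<Rightarrow> hpoly"
  shows "(\<Prod>i\<in>Poly_Mapping.keys (s + t). f i ^ Poly_Mapping.lookup (s + t) i) =
   (\<Prod>i\<in>Poly_Mapping.keys s. f i ^ Poly_Mapping.lookup s i) *
   (\<Prod>i\<in>Poly_Mapping.keys t. f i ^ Poly_Mapping.lookup t i)"
proof -
  let ?A = "Poly_Mapping.keys s \<union> Poly_Mapping.keys t"
  have *: "(\<Prod>i\<in>Poly_Mapping.keys u. f i ^ Poly_Mapping.lookup u i) =
        (\<Prod>i\<in>?A. f i ^ Poly_Mapping.lookup u i)" if "Poly_Mapping.keys u \<subseteq> ?A" for u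
    using that by (intro prod.mono_neutral_left) (auto simp: in_keys_iff)
  show ?thesis
    using *[of s] *[of t] *[OF Poly_Mapping.keys_add]
    by (simp add: lookup_add power_add prod.distrib)
qed

lemma hpoly_sum_monomials:
  "p = (\<Sum>t\<in>Poly_Mapping.keys p. Poly_Mapping.single t (Poly_Mapping.lookup p t))"
  for p :: hpoly
  by (rule poly_mapping_eqI)
    (auto simp: lookup_sum lookup_single when_def in_keys_iff sum.delta)

lemma hsubst_mult: "hsubst f (p * q) = hsubst f p * hsubst f q"
proof -
  have "hsubst f (p * q) = hsubst f
    ((\<Sum>t\<in>Poly_Mapping.keys p. Poly_Mapping.single t (Poly_Mapping.lookup p t)) *
     (\<Sum>t\<in>Poly_Mapping.keys q. Poly_Mapping.single t (Poly_Mapping.lookup q t)))"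
    by (simp flip: hpoly_sum_monomials)
  also have "\<dots> = hsubst f p * hsubst f q"
    by (simp add: sum_product hsubst_sum mult_single hsubst_single monomial_image_add
        const_mult hsubst_def[of f p] hsubst_def[of f q] mult_ac)
  finally show ?thesis .
qed

lemma lam_add: "lam m (p + q) = lam m p + lam m q"
  and lam_mult: "lam m (p * q) = lam m p * lam m q"
  and lam_const: "lam m (const c) = const c"
  by (simp_all add: lam_def hsubst_add hsubst_mult const_def hsubst_single)

lemma lam_h: "r > 0 \<Longrightarrow> lam m (hgen r) = hgen (m * r)"
  by (cases r) (simp_all add: lam_def hgen_def[of "Suc _"] hsubst_single)

lemma lam_hhat_0: "lam m (hhat 0) = 1"
  by (simp add: hhat_def exp_fps_def fps_compose_nth)
     (metis const_1 lam_const)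

text \<open>
  Finitely supported functions on the positive integers are represented by functions on
  the naturals whose value at \<open>0\<close> is disregarded. The product runs over the positive
  part of the support; the other factors of the infinite product are \<open>lam m (hhat 0) = 1\<close>.
\<close>

definition supp_pos :: "(nat \<Rightarrow> nat) \<Rightarrow> nat set" where
  "supp_pos k = {m. m > 0 \<and> k m \<noteq> 0}"

definition b_prod :: "(nat \<Rightarrow> nat) \<Rightarrow> hpoly" where
  "b_prod k = (\<Prod>m\<in>supp_pos k. lam m (hhat (k m)))"

definition B_lam :: "hpoly set" where
  "B_lam = {b_prod k | k. finite (supp_pos k)}"

global_interpretation zmod: module "\<lambda>(z::int) (x::hpoly). of_int z * x"
  defines z_subspace = zmod.subspace
    and z_span = zmod.span
    and z_dependent = zmod.dependent
  by unfold_locales (simp_all add: algebra_simps)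

definition Z_lam :: "hpoly set" where
  "Z_lam = z_span B_lam"

definition z_subalgebra :: "hpoly set \<Rightarrow> bool" where
  "z_subalgebra S \<longleftrightarrow> z_subspace S \<and> 1 \<in> S \<and> (\<forall>x\<in>S. \<forall>y\<in>S. x * y \<in> S)"

definition Z_hhat :: "hpoly set" where
  "Z_hhat = z_subalgebra hull {hhat k | k. k > 0}"

definition z_basis_of :: "hpoly set \<Rightarrow> hpoly set \<Rightarrow> bool" where
  "z_basis_of B M \<longleftrightarrow> B \<subseteq> M \<and> \<not> z_dependent B \<and> z_span B = M"

end

theory Submission
  imports Defs "HOL-Library.FuncSet" "HOL-Library.Nat_Bijection"
begin

text \<open>
  Sending \<open>h_r\<close> to the power sum \<open>\<Sum>j\<in>X. x_j ^ r\<close> of a finite set of variables sends \<open>hhat k\<close> to the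
  \<open>k\<close>-th elementary symmetric polynomial and \<open>lam m (hhat k)\<close> to the monomial symmetric polynomial
  of the partition with \<open>k\<close> parts equal to \<open>m\<close>. Let \<open>I\<close> be the ring of all elements whose images have
  integer coefficients for every \<open>X\<close>. Both the monomials in the \<open>hhat k\<close> and the elements \<open>b_prod k\<close>
  span the polynomial algebra over the rationals, lie in \<open>I\<close>, and are unitriangular with respect to
  suitable coefficients of their images: the lexicographically leading coefficient for the
  former, and for the latter the coefficient of a monomial whose exponents are the parts of the
  partition, where only partitions with more parts can interfere. Hence rational combinations lying
  in \<open>I\<close> have integer coefficients, and both families span \<open>I\<close> over the integers.
\<close>

section \<open>Monomials, constants and substitution homomorphisms\<close>

abbreviation xmon :: "(nat \<Rightarrow>\<^sub>0 nat) \<Rightarrow> hpoly" where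
  "xmon t \<equiv> Poly_Mapping.single t 1"

lemma prod_xmon: "(\<Prod>i\<in>A. xmon (f i)) = xmon (\<Sum>i\<in>A. f i)"
  by (induction A rule: infinite_finite_induct) (simp_all add: mult_single)

lemma xmon_single_power: "xmon (Poly_Mapping.single i a) ^ n = xmon (Poly_Mapping.single i (a * n))"
  by (induction n) (simp_all add: mult_single algebra_simps flip: single_add)

lemma sum_single_keys: "(\<Sum>i\<in>Poly_Mapping.keys t. Poly_Mapping.single i (Poly_Mapping.lookup t i)) = t"
  by (rule poly_mapping_eqI) (auto simp: lookup_sum lookup_single when_def in_keys_iff sum.delta)

lemma const_of_int: "const (of_int z) = of_int z"
  by (simp add: const_def)

lemma const_of_nat: "const (of_nat z) = of_nat z"
  by (simp add: const_def)

lemma lookup_const_mult: "Poly_Mapping.lookup (const c * p) t = c * Poly_Mapping.lookup p t"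
proof -
  have "const c * p = Poly_Mapping.map ((*) c) p"
    unfolding const_def mult_map_scale_conv_mult ..
  then show ?thesis
    by (simp add: Poly_Mapping.map.rep_eq when_def)
qed

lemma xmon_hgen: "(\<Prod>i\<in>Poly_Mapping.keys t. hgen (Suc i) ^ Poly_Mapping.lookup t i) = xmon t"
  unfolding hgen_def xmon_single_power prod_xmon by (simp add: sum_single_keys)

lemma sum_const_mult_xmon: "(\<Sum>t\<in>Poly_Mapping.keys p. const (Poly_Mapping.lookup p t) * xmon t) = p"
  by (simp add: const_def mult_single flip: hpoly_sum_monomials)

lemma hsubst_hgen_Suc: "hsubst (\<lambda>i. hgen (Suc i)) p = p"
  unfolding hsubst_def xmon_hgen by (rule sum_const_mult_xmon)

lemma hsubst_const [simp]: "hsubst f (const c) = const c"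
  by (simp add: const_def hsubst_single)

lemma hsubst_1 [simp]: "hsubst f 1 = 1"
  by (metis const_1 hsubst_const)

lemma hsubst_uminus: "hsubst f (- p) = - hsubst f p"
  by (metis hsubst_add hsubst_zero add.right_inverse add_eq_0_iff)

lemma hsubst_power: "hsubst f (p ^ n) = hsubst f p ^ n"
  by (induction n) (simp_all add: hsubst_mult)

lemma hsubst_prod: "hsubst f (prod g A) = (\<Prod>x\<in>A. hsubst f (g x))"
  by (induction A rule: infinite_finite_induct) (simp_all add: hsubst_mult)

lemma hsubst_of_nat [simp]: "hsubst f (of_nat n) = of_nat n"
  by (metis const_of_nat hsubst_const)

lemma hsubst_of_int [simp]: "hsubst f (of_int n) = of_int n"
  by (metis const_of_int hsubst_const)

lemma hsubst_hgen: "r > 0 \<Longrightarrow> hsubst f (hgen r) = f (r - 1)"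
  by (simp add: hgen_def hsubst_single)

section \<open>Newton's identities and elementary symmetric polynomials\<close>

lemma hhat_0 [simp]: "hhat 0 = 1"
  by (simp add: hhat_def exp_fps_def)

text \<open>If H is the generating series of the \<open>hhat k\<close> and H = exp(G), then H' = G'
  H; this is the coefficient of u^k. Together with \<open>hhat 0 = 1\<close> the recursion
  determines every \<open>hhat k\<close>, as \<open>of_nat (Suc k)\<close> can be cancelled.\<close>

lemma hhat_newton:
  "of_nat (Suc k) * hhat (Suc k) = (\<Sum>i\<le>k. (-1) ^ i * hgen (Suc i) * hhat (k - i))"
proof -
  define G where "G = Abs_fps (\<lambda>r. if r = 0 then 0 else const ((-1) ^ (r - 1) / of_nat r) * hgen r)"
  define E where "E = Abs_fps (\<lambda>n. const (1 / fact n))"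
  have sgn: "const ((-1) ^ n) = (-1) ^ n" for n
    using const_of_int[of "(-1) ^ n"] by simp
  have "fps_deriv E = E"
  proof (rule fps_ext)
    fix n
    have "of_nat (Suc n) * const (1 / fact (Suc n)) = const (of_nat (Suc n) * (1 / fact (Suc n)))"
      by (simp only: const_mult const_of_nat)
    also have "of_nat (Suc n) * (1 / fact (Suc n)) = (1 / fact n :: rat)"
      by (simp add: field_simps del: of_nat_Suc)
    finally show "fps_nth (fps_deriv E) n = fps_nth E n"
      by (simp add: E_def del: of_nat_Suc)
  qed
  moreover have "fps_deriv G = Abs_fps (\<lambda>i. (-1) ^ i * hgen (Suc i))"
  proof (rule fps_ext)
    fix n
    have "of_nat (Suc n) * const ((-1) ^ n / of_nat (Suc n)) = const (of_nat (Suc n) * ((-1) ^ n / of_nat (Suc n)))"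
      by (simp only: const_mult const_of_nat)
    also have "\<dots> = (-1) ^ n"
      by (simp add: sgn del: of_nat_Suc)
    finally show "fps_nth (fps_deriv G) n = fps_nth (Abs_fps (\<lambda>i. (-1) ^ i * hgen (Suc i))) n"
      by (simp add: G_def del: of_nat_Suc flip: mult.assoc)
  qed
  moreover have "fps_deriv (fps_compose E G) = fps_compose (fps_deriv E) G * fps_deriv G"
    by (rule fps_compose_deriv) (simp add: G_def)
  moreover have H: "Abs_fps hhat = fps_compose E G"
    unfolding hhat_gf exp_fps_def G_def E_def ..
  ultimately have "fps_deriv (Abs_fps hhat) = Abs_fps (\<lambda>i. (-1) ^ i * hgen (Suc i)) * Abs_fps hhat"
    by (simp add: mult.commute)
  from arg_cong[OF this, of "\<lambda>P. fps_nth P k"] show ?thesis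
    by (simp add: fps_mult_nth atMost_atLeast0)
qed

text \<open>Over the variables \<open>y j\<close>, the series \<open>\<Prod>j\<in>X. 1 + y j u\<close> satisfies the differential equation
  that determines the \<open>hhat k\<close>.\<close>

lemma hhat_elementary_symmetric:
  fixes \<theta> :: "hpoly \<Rightarrow> hpoly"
  assumes X: "finite X"
    and add: "\<And>p q. \<theta> (p + q) = \<theta> p + \<theta> q"
    and mult: "\<And>p q. \<theta> (p * q) = \<theta> p * \<theta> q"
    and one: "\<theta> 1 = 1"
    and gen: "\<And>r. r > 0 \<Longrightarrow> \<theta> (hgen r) = (\<Sum>j\<in>X. y j ^ r)"
  shows "\<theta> (hhat k) = (\<Sum>A | A \<subseteq> X \<and> card A = k. \<Prod>j\<in>A. y j)"
proof -
  define P where "P Y = (\<Prod>j\<in>Y. 1 + fps_const (y j) * fps_X)" for Y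
  \<comment> \<open>\<open>D j\<close> expands y_j / (1 + y_j u), the logarithmic derivative of one
    factor of \<open>P\<close>.\<close>
  define D where "D j = Abs_fps (\<lambda>i. (-1) ^ i * y j ^ Suc i)" for j
  have D: "(1 + fps_const (y j) * fps_X) * D j = fps_const (y j)" for j
  proof (rule fps_ext)
    fix n
    show "fps_nth ((1 + fps_const (y j) * fps_X) * D j) n = fps_nth (fps_const (y j)) n"
      by (cases n) (simp_all add: D_def distrib_right mult.assoc)
  qed
  have derivP: "fps_deriv (P Y) = P Y * (\<Sum>j\<in>Y. D j)" if "finite Y" for Y
    using that
  proof induction
    case empty
    then show ?case by (simp add: P_def)
  next
    case (insert j Y)
    have "fps_deriv (P (insert j Y)) = (1 + fps_const (y j) * fps_X) * fps_deriv (P Y) + fps_const (y j) * P Y"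
      using insert by (simp add: P_def algebra_simps)
    also have "\<dots> = (1 + fps_const (y j) * fps_X) * P Y * (\<Sum>j\<in>Y. D j) + (1 + fps_const (y j) * fps_X) * D j * P Y"
      using insert by (simp add: D mult.assoc)
    also have "\<dots> = P (insert j Y) * (\<Sum>j\<in>insert j Y. D j)"
      using insert by (simp add: P_def algebra_simps)
    finally show ?case .
  qed
  have P: "fps_nth (P X) k = (\<Sum>A | A \<subseteq> X \<and> card A = k. \<Prod>j\<in>A. y j)" for k
  proof -
    have const_prod: "(\<Prod>j\<in>A. fps_const (y j)) = fps_const (\<Prod>j\<in>A. y j)" for A
      by (induction A rule: infinite_finite_induct) simp_all
    have "P X = (\<Sum>A\<in>Pow X. (\<Prod>j\<in>A. fps_const (y j) * fps_X) * (\<Prod>j\<in>X - A. 1))"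
      unfolding P_def add.commute[of 1] by (rule prod_add[OF X])
    also have "\<dots> = (\<Sum>A\<in>Pow X. fps_const (\<Prod>j\<in>A. y j) * fps_X ^ card A)"
      by (simp add: prod.distrib const_prod)
    finally have "fps_nth (P X) k = (\<Sum>A\<in>Pow X. if card A = k then \<Prod>j\<in>A. y j else 0)"
      by (auto simp: fps_sum_nth intro!: sum.cong)
    also have "\<dots> = (\<Sum>A | A \<subseteq> X \<and> card A = k. \<Prod>j\<in>A. y j)"
      using X by (intro sum.mono_neutral_cong_right) auto
    finally show ?thesis .
  qed
  have zero: "\<theta> 0 = 0"
    using add[of 0 0] by simp
  have neg: "\<theta> (- p) = - \<theta> p" for p
    using add[of p "- p"] by (simp add: zero eq_neg_iff_add_eq_0 add.commute)
  have nat: "\<theta> (of_nat n) = of_nat n" for n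
    by (induction n) (simp_all add: zero add one)
  have sgn: "\<theta> ((-1) ^ i) = (-1) ^ i" for i
    by (induction i) (simp_all add: one neg)
  have sum: "\<theta> (sum g A) = (\<Sum>x\<in>A. \<theta> (g x))" for g and A :: "nat set"
    by (induction A rule: infinite_finite_induct) (simp_all add: zero add)
  have "fps_nth (P X) k = \<theta> (hhat k)"
  proof (induction k rule: less_induct)
    case (less k)
    show ?case
    proof (cases k)
      case 0
      have "{A. A \<subseteq> X \<and> card A = 0} = {{}}"
        using X by (auto simp: finite_subset)
      then show ?thesis by (simp add: P 0 one)
    next
      case (Suc l)
      have "of_nat (Suc l) * fps_nth (P X) (Suc l) = fps_nth (fps_deriv (P X)) l"
        by simp
      also have "\<dots> = fps_nth ((\<Sum>j\<in>X. D j) * P X) l"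
        by (simp add: derivP[OF X] mult.commute)
      also have "\<dots> = (\<Sum>i\<le>l. (-1) ^ i * (\<Sum>j\<in>X. y j ^ Suc i) * fps_nth (P X) (l - i))"
        by (simp add: fps_mult_nth fps_sum_nth D_def atMost_atLeast0 sum_distrib_left)
      also have "\<dots> = (\<Sum>i\<le>l. (-1) ^ i * \<theta> (hgen (Suc i)) * \<theta> (hhat (l - i)))"
        using less Suc by (intro sum.cong) (simp_all add: gen)
      also have "\<dots> = \<theta> (of_nat (Suc l) * hhat (Suc l))"
        unfolding hhat_newton by (simp only: sum mult sgn)
      \<comment> \<open>Both sides obey the same recursion; \<open>of_nat (Suc l)\<close> cancels
        because \<open>hpoly\<close> is a domain of characteristic zero.\<close>
      finally show ?thesis
        unfolding Suc mult nat by (simp del: of_nat_Suc)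
    qed
  qed
  then show ?thesis by (simp add: P)
qed

section \<open>Specialisation to power sums\<close>

text \<open>The target is again \<open>hpoly\<close>, with its variables now read as x_j. Variable
  number \<open>i\<close> of the source is h_(i+1), hence the exponent \<open>Suc i\<close>.\<close>

definition psum :: "nat set \<Rightarrow> hpoly \<Rightarrow> hpoly" where
  "psum X = hsubst (\<lambda>i. \<Sum>j\<in>X. xmon (Poly_Mapping.single j (Suc i)))"

lemma lam_1: "lam 1 p = p"
  by (simp add: lam_def hsubst_hgen_Suc)

lemma psum_hgen: "r > 0 \<Longrightarrow> psum X (hgen r) = (\<Sum>j\<in>X. xmon (Poly_Mapping.single j r))"
  by (simp add: psum_def hsubst_hgen)

text \<open>The composite of \<open>lam m\<close> and \<open>psum X\<close> sends h_r to the r-th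
  power sum of the x_j^m, so the elementary symmetric polynomials arise with y_j = x_j^m.\<close>

lemma psum_lam_hhat:
  assumes "finite X" "m > 0"
  shows "psum X (lam m (hhat k)) =
    (\<Sum>A | A \<subseteq> X \<and> card A = k. xmon (\<Sum>j\<in>A. Poly_Mapping.single j m))"
proof -
  have "psum X (lam m (hhat k)) = (\<Sum>A | A \<subseteq> X \<and> card A = k. \<Prod>j\<in>A. xmon (Poly_Mapping.single j m))"
    using assms
    by (intro hhat_elementary_symmetric[where \<theta> = "\<lambda>p. psum X (lam m p)"])
      (simp_all add: psum_hgen lam_h xmon_single_power, simp_all add: psum_def lam_def hsubst_add hsubst_mult)
  then show ?thesis by (simp add: prod_xmon)
qed

lemma psum_hhat:
  assumes "finite X"
  shows "psum X (hhat k) = (\<Sum>A | A \<subseteq> X \<and> card A = k. xmon (\<Sum>j\<in>A. Poly_Mapping.single j 1))"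
  using psum_lam_hhat[OF assms zero_less_one] by (simp only: lam_1)

section \<open>The ring of elements with integral images\<close>

definition int_coeffs :: "hpoly set" where
  "int_coeffs = {p. \<forall>t. Poly_Mapping.lookup p t \<in> \<int>}"

lemma int_coeffs_sum: "(\<And>x. x \<in> A \<Longrightarrow> f x \<in> int_coeffs) \<Longrightarrow> sum f A \<in> int_coeffs"
  by (auto simp: int_coeffs_def lookup_sum)

lemma int_coeffs_single: "c \<in> \<int> \<Longrightarrow> Poly_Mapping.single t c \<in> int_coeffs"
  by (auto simp: int_coeffs_def lookup_single when_def)

lemma int_coeffs_mult:
  assumes "p \<in> int_coeffs" "q \<in> int_coeffs"
  shows "p * q \<in> int_coeffs"
proof -
  have "p * q = (\<Sum>s\<in>Poly_Mapping.keys p. \<Sum>t\<in>Poly_Mapping.keys q.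
      Poly_Mapping.single (s + t) (Poly_Mapping.lookup p s * Poly_Mapping.lookup q t))"
    by (subst hpoly_sum_monomials[of p], subst hpoly_sum_monomials[of q]) (simp add: sum_product mult_single)
  also have "\<dots> \<in> int_coeffs"
    using assms by (intro int_coeffs_sum int_coeffs_single) (auto simp: int_coeffs_def)
  finally show ?thesis .
qed

text \<open>The ring \<open>I\<close> of the overview. Letting \<open>X\<close> range over all
  finite sets matters: a fixed \<open>psum X\<close> kills every \<open>hhat k\<close> with
  \<open>k > card X\<close>.\<close>

definition sym_integral :: "hpoly set" where
  "sym_integral = {p. \<forall>X. finite X \<longrightarrow> psum X p \<in> int_coeffs}"

lemma sym_integral_mult: "p \<in> sym_integral \<Longrightarrow> q \<in> sym_integral \<Longrightarrow> p * q \<in> sym_integral"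
  by (simp add: sym_integral_def psum_def hsubst_mult int_coeffs_mult)

lemma sym_integral_add: "p \<in> sym_integral \<Longrightarrow> q \<in> sym_integral \<Longrightarrow> p + q \<in> sym_integral"
  by (auto simp: sym_integral_def psum_def hsubst_add int_coeffs_def lookup_add)

lemma sym_integral_of_int: "of_int z \<in> sym_integral"
proof -
  have "psum X (of_int z) = Poly_Mapping.single 0 (of_int z)" for X
    by (simp add: psum_def)
  then show ?thesis
    by (simp add: sym_integral_def int_coeffs_single del: single_of_int)
qed

lemma sym_integral_1: "1 \<in> sym_integral"
  using sym_integral_of_int[of 1] by simp

lemma sym_integral_prod: "(\<And>x. x \<in> A \<Longrightarrow> f x \<in> sym_integral) \<Longrightarrow> prod f A \<in> sym_integral"
  by (induction A rule: infinite_finite_induct) (simp_all add: sym_integral_1 sym_integral_mult)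

lemma sym_integral_power: "p \<in> sym_integral \<Longrightarrow> p ^ n \<in> sym_integral"
  by (induction n) (simp_all add: sym_integral_1 sym_integral_mult)

lemma z_subalgebra_sym_integral: "z_subalgebra sym_integral"
  unfolding z_subalgebra_def zmod.subspace_def
  using sym_integral_of_int[of 0]
  by (simp add: sym_integral_add sym_integral_mult sym_integral_of_int sym_integral_1)

lemma sym_integral_lam_hhat: "m > 0 \<Longrightarrow> lam m (hhat k) \<in> sym_integral"
  by (simp add: sym_integral_def psum_lam_hhat int_coeffs_sum int_coeffs_single)

lemma sym_integral_hhat: "hhat k \<in> sym_integral"
  using sym_integral_lam_hhat[OF zero_less_one] by (simp only: lam_1)

section \<open>Unitriangular systems and integrality\<close>

text \<open>The coefficient of \<open>\<tau> i\<close> in \<open>psum (X i) p\<close> is an integer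
  and equals \<open>c i\<close> plus integer multiples of those \<open>c j\<close> with
  \<open>r i < r j\<close>. Solving from the largest rank downwards gives integers; the induction
  counts the indices of larger rank, so any linear order can serve as rank.\<close>

lemma sym_integral_triangular:
  fixes g :: "'a \<Rightarrow> hpoly" and r :: "'a \<Rightarrow> 'o :: linorder"
  assumes T: "finite T"
    and p: "p = (\<Sum>i\<in>T. const (c i) * g i)" "p \<in> sym_integral"
    and g: "\<And>i. i \<in> T \<Longrightarrow> g i \<in> sym_integral"
    and X: "\<And>i. i \<in> T \<Longrightarrow> finite (X i)"
    and diag: "\<And>i. i \<in> T \<Longrightarrow> Poly_Mapping.lookup (psum (X i) (g i)) (\<tau> i) = 1"
    and off: "\<And>i j. i \<in> T \<Longrightarrow> j \<in> T \<Longrightarrow> i \<noteq> j \<Longrightarrow>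
      Poly_Mapping.lookup (psum (X i) (g j)) (\<tau> i) \<noteq> 0 \<Longrightarrow> r i < r j"
  shows "i \<in> T \<Longrightarrow> c i \<in> \<int>"
proof (induction "card {j \<in> T. r i < r j}" arbitrary: i rule: less_induct)
  case less
  let ?L = "\<lambda>p. Poly_Mapping.lookup (psum (X i) p) (\<tau> i)"
  have Lint: "?L q \<in> \<int>" if "q \<in> sym_integral" for q
    using that X[OF less.prems] by (auto simp: sym_integral_def int_coeffs_def)
  have "?L p = (\<Sum>j\<in>T. c j * ?L (g j))"
    unfolding p psum_def by (simp add: hsubst_sum hsubst_mult lookup_sum lookup_const_mult)
  also have "\<dots> = c i + (\<Sum>j\<in>T - {i}. c j * ?L (g j))"
    using T less.prems by (simp add: sum.remove diag)
  finally have "c i = ?L p - (\<Sum>j\<in>T - {i}. c j * ?L (g j))"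
    by simp
  moreover have "(\<Sum>j\<in>T - {i}. c j * ?L (g j)) \<in> \<int>"
  proof (rule Ints_sum)
    fix j assume j: "j \<in> T - {i}"
    show "c j * ?L (g j) \<in> \<int>"
    proof (cases "?L (g j) = 0")
      case False
      with j off[OF less.prems, of j] have "r i < r j" by auto
      then have "{k \<in> T. r j < r k} \<subset> {k \<in> T. r i < r k}"
        using j by auto
      then have "c j \<in> \<int>"
        using j T by (intro less.hyps psubset_card_mono) auto
      then show ?thesis
        using j g Lint by auto
    qed simp
  qed
  ultimately show ?case
    using Lint[OF p(2)] by simp
qed

lemma sum_const_Ints_in_z_span:
  assumes "\<And>i. i \<in> T \<Longrightarrow> c i \<in> \<int>"
  shows "(\<Sum>i\<in>T. const (c i) * g i) \<in> z_span (g ` T)"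
proof (rule zmod.span_sum)
  fix i assume i: "i \<in> T"
  then obtain z where "c i = of_int z"
    using assms by (meson Ints_cases)
  then show "const (c i) * g i \<in> z_span (g ` T)"
    using i by (simp add: const_of_int zmod.span_scale zmod.span_base)
qed

section \<open>Lexicographic leading terms\<close>

lemma lookup_sum_single:
  "finite A \<Longrightarrow> Poly_Mapping.lookup (\<Sum>j\<in>A. Poly_Mapping.single j m) i = (if i \<in> A then m else 0)"
  by (simp add: lookup_sum lookup_single when_def sum.delta)

text \<open>The order is lexicographic, decided at the smallest index where two exponent vectors
  differ. The value \<open>a\<close> may be 0, in which case \<open>t\<close> is only an upper
  bound; this keeps the statements valid when \<open>X\<close> has too few variables.\<close>

definition leading :: "hpoly \<Rightarrow> (nat \<Rightarrow>\<^sub>0 nat) \<Rightarrow> rat \<Rightarrow> bool" where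
  "leading p t a \<longleftrightarrow> (\<forall>s\<in>Poly_Mapping.keys p. s \<le> t) \<and> Poly_Mapping.lookup p t = a"

lemma leading_1: "leading 1 0 1"
  by (simp add: leading_def flip: single_one)

text \<open>Addition is strictly monotone for this order, so two exponents below \<open>s\<close>
  and \<open>t\<close> add up to \<open>s + t\<close> only if both bounds are attained.\<close>

lemma leading_mult:
  assumes "leading p s a" "leading q t b"
  shows "leading (p * q) (s + t) (a * b)"
proof -
  have le: "u + v \<le> s + t" "u + v = s + t \<longleftrightarrow> u = s \<and> v = t"
    if "u \<in> Poly_Mapping.keys p" "v \<in> Poly_Mapping.keys q" for u v
  proof -
    have uv: "u \<le> s" "v \<le> t"
      using that assms by (auto simp: leading_def)
    then show "u + v \<le> s + t" by (rule add_mono)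
    show "u + v = s + t \<longleftrightarrow> u = s \<and> v = t"
      using uv by (metis add_less_le_mono add_le_less_mono add_left_cancel order_le_less less_irrefl)
  qed
  have "Poly_Mapping.lookup (p * q) (s + t) = (\<Sum>u\<in>Poly_Mapping.keys p. \<Sum>v\<in>Poly_Mapping.keys q.
      Poly_Mapping.lookup (Poly_Mapping.single (u + v) (Poly_Mapping.lookup p u * Poly_Mapping.lookup q v)) (s + t))"
    by (subst (1) hpoly_sum_monomials[of p], subst (1) hpoly_sum_monomials[of q])
      (simp add: sum_product mult_single lookup_sum)
  also have "\<dots> = (\<Sum>u\<in>Poly_Mapping.keys p. \<Sum>v\<in>Poly_Mapping.keys q.
      if u = s then if v = t then Poly_Mapping.lookup p u * Poly_Mapping.lookup q v else 0 else 0)"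
    by (intro sum.cong refl) (simp add: lookup_single when_def le)
  also have "\<dots> = (\<Sum>u\<in>Poly_Mapping.keys p. if u = s then Poly_Mapping.lookup p u * b else 0)"
    using assms by (intro sum.cong refl) (auto simp: leading_def in_keys_iff)
  also have "\<dots> = a * b"
    using assms by (auto simp: leading_def in_keys_iff)
  finally show ?thesis
    using le(1) keys_mult[of p q] by (fastforce simp: leading_def)
qed

lemma leading_power: "leading p s a \<Longrightarrow> leading (p ^ n) (\<Sum>l<n. s) (a ^ n)"
proof (induction n)
  case (Suc n)
  then show ?case
    using leading_mult[of p s a "p ^ n" "\<Sum>l<n. s" "a ^ n"]
    by (simp only: sum.lessThan_Suc power_Suc add.commute)
qed (simp add: leading_1)

lemma leading_prod:
  "(\<And>x. x \<in> A \<Longrightarrow> leading (f x) (\<tau> x) (a x)) \<Longrightarrow> leading (prod f A) (sum \<tau> A) (prod a A)"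
  by (induction A rule: infinite_finite_induct) (simp_all add: leading_1 leading_mult)

text \<open>At the smallest \<open>l\<close> where \<open>A\<close> and \<open>{..<k}\<close>
  differ, \<open>l\<close> lies in the initial segment: otherwise \<open>A\<close> would contain
  \<open>{..<k}\<close> and \<open>l\<close>, more than \<open>k\<close> elements. Thus the initial
  segment wins at \<open>l\<close>.\<close>

lemma sum_single_le_initial:
  assumes "finite A" "card A = k"
  shows "(\<Sum>j\<in>A. Poly_Mapping.single j (1::nat)) \<le> (\<Sum>j<k. Poly_Mapping.single j 1)"
proof (cases "A = {..<k}")
  case False
  define D where "D = sym_diff A {..<k}"
  define l where "l = (LEAST l. l \<in> D)"
  have "D \<noteq> {}"
    using False by (auto simp: D_def)
  then have l: "l \<in> D"
    unfolding l_def by (meson LeastI ex_in_conv)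
  have least: "i \<in> A \<longleftrightarrow> i < k" if "i < l" for i
    using not_less_Least[of i "\<lambda>l. l \<in> D"] that by (auto simp: D_def l_def)
  have "l \<notin> A"
  proof
    assume "l \<in> A"
    with l have "k \<le> l" by (auto simp: D_def)
    with least \<open>l \<in> A\<close> have "insert l {..<k} \<subseteq> A" by auto
    then have "card (insert l {..<k}) \<le> card A"
      using assms by (intro card_mono)
    then show False
      using \<open>k \<le> l\<close> assms by simp
  qed
  with l have "l < k" by (auto simp: D_def)
  have "(\<Sum>j\<in>A. Poly_Mapping.single j (1::nat)) < (\<Sum>j<k. Poly_Mapping.single j 1)"
    unfolding less_poly_mapping.rep_eq less_fun_def
    using \<open>l \<notin> A\<close> \<open>l < k\<close> least assms by (intro exI[of _ l]) (auto simp: lookup_sum_single)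
  then show ?thesis by simp
qed simp

text \<open>Different subsets give different monomials, so the largest one, x_0 ... x_(k-1), occurs
  exactly once if its variables belong to \<open>X\<close> and not at all otherwise.\<close>

lemma leading_psum_hhat:
  assumes X: "finite X"
  shows "leading (psum X (hhat k)) (\<Sum>j<k. Poly_Mapping.single j 1) (if {..<k} \<subseteq> X then 1 else 0)"
proof -
  let ?s = "\<lambda>A. \<Sum>j\<in>A. Poly_Mapping.single j (1::nat)"
  have inj: "?s A = ?s {..<k} \<longleftrightarrow> A = {..<k}" if "finite A" for A
  proof
    assume "?s A = ?s {..<k}"
    then have "Poly_Mapping.lookup (?s A) i = Poly_Mapping.lookup (?s {..<k}) i" for i
      by simp
    then have "i \<in> A \<longleftrightarrow> i < k" for i
      using that by (simp add: lookup_sum_single) (metis nat.distinct(1))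
    then show "A = {..<k}"
      by auto
  qed simp
  have fin: "finite A" if "A \<subseteq> X" for A
    using X that by (rule rev_finite_subset)
  have "s \<le> ?s {..<k}" if "s \<in> Poly_Mapping.keys (psum X (hhat k))" for s
  proof -
    have "s \<in> (\<Union>A\<in>{A. A \<subseteq> X \<and> card A = k}. Poly_Mapping.keys (xmon (?s A)))"
      using that keys_sum[of "\<lambda>A. xmon (?s A)"] unfolding psum_hhat[OF X] by (rule subsetD[rotated])
    then obtain A where A: "A \<subseteq> X" "card A = k" "s = ?s A"
      by auto
    show ?thesis
      unfolding A(3) by (rule sum_single_le_initial[OF fin[OF A(1)] A(2)])
  qed
  moreover have "Poly_Mapping.lookup (psum X (hhat k)) (?s {..<k}) =
      (\<Sum>A | A \<subseteq> X \<and> card A = k. if A = {..<k} then 1 else 0)"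
    unfolding psum_hhat[OF X] lookup_sum[of _ "{A. A \<subseteq> X \<and> card A = k}"]
  proof (intro sum.cong refl)
    fix A assume "A \<in> {A. A \<subseteq> X \<and> card A = k}"
    then have "?s A = ?s {..<k} \<longleftrightarrow> A = {..<k}"
      using inj fin by blast
    then show "Poly_Mapping.lookup (xmon (?s A)) (?s {..<k}) = (if A = {..<k} then 1 else 0)"
      by (simp only: lookup_single when_def)
  qed
  ultimately show ?thesis
    using X by (simp add: leading_def sum.delta)
qed

section \<open>Monomials in the \<open>hhat k\<close> and the algebra they generate\<close>

definition emon :: "(nat \<Rightarrow>\<^sub>0 nat) \<Rightarrow> hpoly" where
  "emon c = (\<Prod>i\<in>Poly_Mapping.keys c. hhat (Suc i) ^ Poly_Mapping.lookup c i)"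

text \<open>If \<open>c\<close> is read as the partition with \<open>c i\<close> parts equal to
  \<open>i + 1\<close>, this is the conjugate partition: entry \<open>j\<close> counts the parts
  larger than \<open>j\<close>.\<close>

definition emon_exp :: "(nat \<Rightarrow>\<^sub>0 nat) \<Rightarrow> (nat \<Rightarrow>\<^sub>0 nat)" where
  "emon_exp c = (\<Sum>i\<in>Poly_Mapping.keys c. \<Sum>l<Poly_Mapping.lookup c i. \<Sum>j<Suc i. Poly_Mapping.single j 1)"

lemma leading_psum_emon:
  assumes "finite X"
  shows "leading (psum X (emon c)) (emon_exp c)
    (\<Prod>i\<in>Poly_Mapping.keys c. (if {..<Suc i} \<subseteq> X then 1 else 0) ^ Poly_Mapping.lookup c i)"
proof -
  have "psum X (emon c) = (\<Prod>i\<in>Poly_Mapping.keys c. psum X (hhat (Suc i)) ^ Poly_Mapping.lookup c i)"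
    by (simp add: emon_def psum_def hsubst_prod hsubst_power)
  moreover have "leading (\<Prod>i\<in>Poly_Mapping.keys c. psum X (hhat (Suc i)) ^ Poly_Mapping.lookup c i) (emon_exp c)
      (\<Prod>i\<in>Poly_Mapping.keys c. (if {..<Suc i} \<subseteq> X then 1 else 0) ^ Poly_Mapping.lookup c i)"
    unfolding emon_exp_def by (rule leading_prod, rule leading_power, rule leading_psum_hhat, rule assms)
  ultimately show ?thesis
    by metis
qed

lemma lookup_emon_exp:
  "Poly_Mapping.lookup (emon_exp c) j = (\<Sum>i\<in>Poly_Mapping.keys c. if j \<le> i then Poly_Mapping.lookup c i else 0)"
proof -
  have initial: "Poly_Mapping.lookup (\<Sum>j<Suc i. Poly_Mapping.single j 1) j = (if j \<le> i then 1 else 0)" for i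
    using lookup_sum_single[of "{..<Suc i}" 1 j, OF finite_lessThan] by (simp only: lessThan_iff less_Suc_eq_le)
  have copies: "Poly_Mapping.lookup (\<Sum>l<n. s) j = n * Poly_Mapping.lookup s j" for n and s :: "nat \<Rightarrow>\<^sub>0 nat"
    by (simp only: lookup_sum) simp
  show ?thesis
    unfolding emon_exp_def lookup_sum[of _ "Poly_Mapping.keys c"] copies initial
    by (intro sum.cong) auto
qed

text \<open>The multiplicities of a partition are the differences of consecutive entries of its
  conjugate.\<close>

lemma inj_emon_exp: "inj emon_exp"
proof (rule injI, rule poly_mapping_eqI)
  fix c d j assume eq: "emon_exp c = emon_exp d"
  have diff: "Poly_Mapping.lookup (emon_exp c) j =
      Poly_Mapping.lookup c j + Poly_Mapping.lookup (emon_exp c) (Suc j)" for c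
  proof -
    have "Poly_Mapping.lookup (emon_exp c) j = (\<Sum>i\<in>Poly_Mapping.keys c.
        (if i = j then Poly_Mapping.lookup c i else 0) + (if Suc j \<le> i then Poly_Mapping.lookup c i else 0))"
      unfolding lookup_emon_exp by (intro sum.cong) auto
    then show ?thesis
      unfolding sum.distrib lookup_emon_exp[of c "Suc j"] by (simp add: in_keys_iff)
  qed
  show "Poly_Mapping.lookup c j = Poly_Mapping.lookup d j"
    using diff[of c] diff[of d] unfolding eq by linarith
qed

text \<open>In Newton's identity for \<open>hhat (Suc r)\<close> the generator h_(r+1) occurs only
  in the last term, with coefficient 1 or -1 because \<open>hhat 0 = 1\<close>. Solving for it
  leaves only \<open>hhat\<close> values and earlier generators.\<close>

lemma hgen_in_range_hsubst_hhat: "hgen (Suc r) \<in> range (hsubst (\<lambda>i. hhat (Suc i)))"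
proof (induction r rule: less_induct)
  case (less r)
  let ?R = "range (hsubst (\<lambda>i. hhat (Suc i)))"
  have closed: "p + q \<in> ?R" "p * q \<in> ?R" if "p \<in> ?R" "q \<in> ?R" for p q
    using that by (auto simp flip: hsubst_add hsubst_mult)
  have minus: "- p \<in> ?R" if "p \<in> ?R" for p
    using that by (auto simp flip: hsubst_uminus)
  have const: "const c \<in> ?R" for c
    by (rule range_eqI[of _ _ "const c"]) simp
  have one: "1 \<in> ?R"
    using const[of 1] by simp
  have hhat: "hhat k \<in> ?R" for k
  proof (cases k)
    case (Suc l)
    then show ?thesis
      by (intro range_eqI[of _ _ "hgen (Suc l)"]) (simp add: hsubst_hgen)
  qed (simp add: one)
  have sum: "sum f A \<in> ?R" if "\<And>x. x \<in> A \<Longrightarrow> f x \<in> ?R" for f and A :: "nat set"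
    using that const[of 0] by (induction A rule: infinite_finite_induct) (simp_all add: closed)
  have sgn: "(-1) ^ i \<in> ?R" for i
    by (induction i) (simp_all add: one minus)
  have "of_nat (Suc r) * hhat (Suc r) =
      (\<Sum>i<r. (-1) ^ i * hgen (Suc i) * hhat (r - i)) + (-1) ^ r * hgen (Suc r)"
    unfolding hhat_newton by (simp flip: lessThan_Suc_atMost)
  then have "(-1) ^ r * hgen (Suc r) =
      of_nat (Suc r) * hhat (Suc r) + - (\<Sum>i<r. (-1) ^ i * hgen (Suc i) * hhat (r - i))"
    by (simp only: diff_conv_add_uminus[symmetric] add_diff_cancel_left')
  also have "\<dots> \<in> ?R"
    using less const[of "of_nat (Suc r)"] hhat sgn
    by (intro closed minus sum) (simp_all only: const_of_nat lessThan_iff)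
  finally have "(-1) ^ r * ((-1) ^ r * hgen (Suc r)) \<in> ?R"
    by (rule closed(2)[OF sgn])
  moreover have "(-1) ^ r * ((-1) ^ r * hgen (Suc r)) = hgen (Suc r)"
    by (simp flip: mult.assoc power_mult_distrib)
  ultimately show ?case by (simp only:)
qed

text \<open>Each generator has a preimage \<open>f i\<close>; since substitutions are homomorphisms
  fixing the rationals, \<open>hsubst f p\<close> is a preimage of \<open>p\<close>.\<close>

lemma hsubst_hhat_surj: "\<exists>q. p = hsubst (\<lambda>i. hhat (Suc i)) q"
proof -
  have "\<forall>i. \<exists>q. hgen (Suc i) = hsubst (\<lambda>i. hhat (Suc i)) q"
    using hgen_in_range_hsubst_hhat by auto
  then obtain f where f: "hgen (Suc i) = hsubst (\<lambda>i. hhat (Suc i)) (f i)" for i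
    by metis
  have "p = hsubst (\<lambda>i. hgen (Suc i)) p"
    by (simp add: hsubst_hgen_Suc)
  also have "\<dots> = hsubst (\<lambda>i. hhat (Suc i)) (hsubst f p)"
    unfolding hsubst_def[of _ p] f
    by (simp add: hsubst_sum hsubst_mult hsubst_prod hsubst_power)
  finally show ?thesis ..
qed

lemma sym_integral_subset_span_emon: "sym_integral \<subseteq> z_span (range emon)"
proof
  fix p assume p: "p \<in> sym_integral"
  obtain q where q: "p = hsubst (\<lambda>i. hhat (Suc i)) q"
    using hsubst_hhat_surj by blast
  define T where "T = Poly_Mapping.keys q"
  \<comment> \<open>\<open>X c\<close> contains all variables of the leading monomials of the
    factors of \<open>emon c\<close>, which makes the diagonal coefficient 1.\<close>
  define X where "X c = (\<Union>i\<in>Poly_Mapping.keys c. {..<Suc i})" for c :: "nat \<Rightarrow>\<^sub>0 nat"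
  have pT: "p = (\<Sum>c\<in>T. const (Poly_Mapping.lookup q c) * emon c)"
    unfolding q T_def emon_def hsubst_def ..
  have "Poly_Mapping.lookup q c \<in> \<int>" if "c \<in> T" for c
  proof (rule sym_integral_triangular[OF _ pT p, where r = emon_exp and \<tau> = emon_exp and X = X, OF _ _ _ _ _ that])
    show "finite T" by (simp add: T_def)
    show "emon c \<in> sym_integral" for c
      by (simp add: emon_def sym_integral_prod sym_integral_power sym_integral_hhat)
    show fin: "finite (X c)" for c
      by (simp add: X_def)
    show "Poly_Mapping.lookup (psum (X c) (emon c)) (emon_exp c) = 1" for c
    proof -
      have "{..<Suc i} \<subseteq> X c" if "i \<in> Poly_Mapping.keys c" for i
        using that unfolding X_def by blast
      then show ?thesis
        using leading_psum_emon[OF fin, of c c] by (simp add: leading_def)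
    qed
    \<comment> \<open>The bound by \<open>emon_exp d\<close> holds for any finite set of variables;
      injectivity of \<open>emon_exp\<close> makes it strict.\<close>
    show "emon_exp c < emon_exp d"
      if "c \<noteq> d" "Poly_Mapping.lookup (psum (X c) (emon d)) (emon_exp c) \<noteq> 0" for c d
    proof -
      have "emon_exp c \<le> emon_exp d"
        using that leading_psum_emon[OF fin, of c d] by (simp add: leading_def in_keys_iff)
      then show ?thesis
        using that inj_emon_exp by (simp add: order_less_le inj_eq)
    qed
  qed
  then have "p \<in> z_span (emon ` T)"
    unfolding pT by (intro sum_const_Ints_in_z_span)
  then show "p \<in> z_span (range emon)"
    using zmod.span_mono[of "emon ` T" "range emon"] by blast
qed

lemma Z_hhat_eq_sym_integral: "Z_hhat = sym_integral"
proof
  show "Z_hhat \<subseteq> sym_integral"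
    unfolding Z_hhat_def using z_subalgebra_sym_integral
    by (intro hull_minimal) (auto simp: sym_integral_hhat)
next
  \<comment> \<open>The hull is the intersection of all such \<open>S\<close>.\<close>
  have "z_span (range emon) \<subseteq> S" if S: "z_subalgebra S" "{hhat k | k. k > 0} \<subseteq> S" for S
  proof (rule zmod.span_minimal)
    have one: "1 \<in> S" and mult: "x \<in> S \<Longrightarrow> y \<in> S \<Longrightarrow> x * y \<in> S" for x y
      using S(1) by (auto simp: z_subalgebra_def)
    have power: "x ^ n \<in> S" if "x \<in> S" for x n
      using that by (induction n) (simp_all add: one mult)
    have prod: "prod f A \<in> S" if "\<And>i. i \<in> A \<Longrightarrow> f i \<in> S" for f and A :: "nat set"
      using that by (induction A rule: infinite_finite_induct) (simp_all add: one mult)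
    show "range emon \<subseteq> S"
      using S(2) by (auto simp: emon_def intro!: prod power)
    show "z_subspace S"
      using S(1) by (simp add: z_subalgebra_def)
  qed
  then show "sym_integral \<subseteq> Z_hhat"
    unfolding Z_hhat_def hull_def using sym_integral_subset_span_emon by blast
qed

section \<open>Images of the elements \<open>b_prod k\<close>\<close>

definition num_parts :: "(nat \<Rightarrow> nat) \<Rightarrow> nat" where
  "num_parts k = (\<Sum>m\<in>supp_pos k. k m)"

text \<open>Indexes the terms obtained by expanding the product over \<open>m\<close> of elementary
  symmetric polynomials in the x_j^m. Sets chosen for different \<open>m\<close> may overlap, and
  then exponents add up.\<close>

definition part_choices :: "nat set \<Rightarrow> (nat \<Rightarrow> nat) \<Rightarrow> (nat \<Rightarrow> nat set) set" where
  "part_choices X k = (\<Pi>\<^sub>E m\<in>supp_pos k. {A. A \<subseteq> X \<and> card A = k m})"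

definition choice_exp :: "(nat \<Rightarrow> nat) \<Rightarrow> (nat \<Rightarrow> nat set) \<Rightarrow> (nat \<Rightarrow>\<^sub>0 nat)" where
  "choice_exp k A = (\<Sum>m\<in>supp_pos k. \<Sum>j\<in>A m. Poly_Mapping.single j m)"

lemma finite_part_choices: "finite X \<Longrightarrow> finite (supp_pos k) \<Longrightarrow> finite (part_choices X k)"
  unfolding part_choices_def by (rule finite_PiE) auto

lemma psum_b_prod:
  assumes X: "finite X" and k: "finite (supp_pos k)"
  shows "psum X (b_prod k) = (\<Sum>A\<in>part_choices X k. xmon (choice_exp k A))"
proof -
  have "psum X (b_prod k) = (\<Prod>m\<in>supp_pos k. psum X (lam m (hhat (k m))))"
    by (simp add: b_prod_def psum_def hsubst_prod)
  also have "\<dots> = (\<Prod>m\<in>supp_pos k. \<Sum>A | A \<subseteq> X \<and> card A = k m. xmon (\<Sum>j\<in>A. Poly_Mapping.single j m))"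
    using X by (intro prod.cong refl psum_lam_hhat) (auto simp: supp_pos_def)
  also have "\<dots> = (\<Sum>A\<in>part_choices X k. \<Prod>m\<in>supp_pos k. xmon (\<Sum>j\<in>A m. Poly_Mapping.single j m))"
    unfolding part_choices_def using X k by (intro prod_sum_PiE) auto
  finally show ?thesis
    by (simp add: prod_xmon choice_exp_def)
qed

lemma lookup_choice_exp:
  assumes "\<And>m. m \<in> supp_pos k \<Longrightarrow> finite (A m)"
  shows "Poly_Mapping.lookup (choice_exp k A) j = (\<Sum>m\<in>supp_pos k. if j \<in> A m then m else 0)"
  unfolding choice_exp_def lookup_sum[of _ "supp_pos k"]
  by (intro sum.cong refl lookup_sum_single assms)

lemma keys_choice_exp:
  assumes "finite (supp_pos k)" "\<And>m. m \<in> supp_pos k \<Longrightarrow> finite (A m)"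
  shows "Poly_Mapping.keys (choice_exp k A) = (\<Union>m\<in>supp_pos k. A m)"
proof (intro set_eqI)
  fix j
  have "j \<in> Poly_Mapping.keys (choice_exp k A) \<longleftrightarrow> (\<Sum>m\<in>supp_pos k. if j \<in> A m then m else 0) \<noteq> 0"
    using lookup_choice_exp[of k A j] assms(2) unfolding in_keys_iff by auto
  also have "\<dots> \<longleftrightarrow> j \<in> (\<Union>m\<in>supp_pos k. A m)"
    unfolding sum_eq_0_iff[OF assms(1)] by (auto simp: supp_pos_def)
  finally show "j \<in> Poly_Mapping.keys (choice_exp k A) \<longleftrightarrow> j \<in> (\<Union>m\<in>supp_pos k. A m)" .
qed

text \<open>If a product of \<open>num_parts k\<close> variable powers involves at least \<open>num_parts k\<close> variables, then no two
  of the powers share a variable, so that the factors can be read off the monomial.\<close>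

lemma choice_exp_determines:
  assumes k: "finite (supp_pos k)" and X: "finite X" and A: "A \<in> part_choices X k"
    and parts: "num_parts k \<le> card (Poly_Mapping.keys (choice_exp k A))"
  shows "m \<in> supp_pos k \<Longrightarrow> A m = {j. Poly_Mapping.lookup (choice_exp k A) j = m}"
    and "m > 0 \<Longrightarrow> k m = card {j. Poly_Mapping.lookup (choice_exp k A) j = m}"
proof -
  define S where "S = supp_pos k"
  define U where "U = (\<Union>m\<in>S. A m)"
  have A': "A m \<subseteq> X" "card (A m) = k m" if "m \<in> S" for m
    using A that by (auto simp: part_choices_def S_def)
  have fin: "finite (A m)" if "m \<in> S" for m
    using A'(1)[OF that] X by (rule finite_subset)
  have U: "Poly_Mapping.keys (choice_exp k A) = U"
    unfolding U_def S_def using k fin S_def by (intro keys_choice_exp) auto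
  have finU: "finite U"
    using finite_keys U by metis
  \<comment> \<open>Double counting of the pairs with \<open>j \<in> A m\<close>: there are
    \<open>num_parts k\<close> of them, at most \<open>card U\<close>, while each
    \<open>j \<in> U\<close> occurs at least once. Hence each occurs exactly once.\<close>
  have "(\<Sum>j\<in>U. card {m \<in> S. j \<in> A m}) = (\<Sum>m\<in>S. card {j \<in> U. j \<in> A m})"
    using sum.swap_restrict[OF finU, of S "\<lambda>_ _. 1 :: nat" "\<lambda>j m. j \<in> A m"] k by (simp add: S_def)
  also have "\<dots> = (\<Sum>m\<in>S. k m)"
  proof (intro sum.cong refl)
    fix m assume m: "m \<in> S"
    then have "{j \<in> U. j \<in> A m} = A m"
      by (auto simp: U_def)
    then show "card {j \<in> U. j \<in> A m} = k m"
      using A'(2)[OF m] by simp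
  qed
  also have "\<dots> \<le> (\<Sum>j\<in>U. 1)"
    using parts by (simp add: num_parts_def U S_def)
  finally have le: "(\<Sum>j\<in>U. card {m \<in> S. j \<in> A m}) \<le> (\<Sum>j\<in>U. 1)" .
  have ge: "1 \<le> card {m \<in> S. j \<in> A m}" if "j \<in> U" for j
    using that k by (auto simp: U_def S_def Suc_le_eq card_gt_0_iff)
  have one: "card {m \<in> S. j \<in> A m} = 1" if "j \<in> U" for j
  proof -
    have "(\<Sum>j\<in>U. 1) = (\<Sum>j\<in>U. card {m \<in> S. j \<in> A m})"
      using ge by (intro antisym sum_mono le)
    from sum_mono_inv[OF this ge that finU] show ?thesis ..
  qed
  have lookup: "Poly_Mapping.lookup (choice_exp k A) j = m" if m: "m \<in> S" "j \<in> A m" for j m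
  proof -
    have "j \<in> U"
      using m by (auto simp: U_def)
    then obtain m' where "{m \<in> S. j \<in> A m} = {m'}"
      using one card_1_singletonE by metis
    with m have single: "{m \<in> S. j \<in> A m} = {m}"
      by auto
    have "Poly_Mapping.lookup (choice_exp k A) j = (\<Sum>m\<in>S. if j \<in> A m then m else 0)"
      using lookup_choice_exp[of k A j] fin unfolding S_def by blast
    also have "\<dots> = (\<Sum>m\<in>{m \<in> S. j \<in> A m}. m)"
      using k by (simp add: S_def sum.inter_filter)
    finally show ?thesis
      by (simp add: single)
  qed
  \<comment> \<open>A positive exponent puts \<open>j\<close> into some \<open>A m'\<close>, and by
    \<open>lookup\<close> the exponent is then \<open>m'\<close>. This also shows that no exponent
    equals a positive \<open>m\<close> outside the support.\<close>
  have preimage: "\<exists>m'\<in>S. j \<in> A m' \<and> m' = m" if "Poly_Mapping.lookup (choice_exp k A) j = m" "m > 0" for j m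
  proof -
    have "j \<in> U"
      using that unfolding U[symmetric] by (simp add: in_keys_iff)
    then obtain m' where "m' \<in> S" "j \<in> A m'"
      by (auto simp: U_def)
    then show ?thesis
      using lookup that by blast
  qed
  show eq: "A m = {j. Poly_Mapping.lookup (choice_exp k A) j = m}" if "m \<in> supp_pos k" for m
  proof
    show "A m \<subseteq> {j. Poly_Mapping.lookup (choice_exp k A) j = m}"
      using that lookup by (auto simp: S_def)
    show "{j. Poly_Mapping.lookup (choice_exp k A) j = m} \<subseteq> A m"
      using that preimage[of _ m] by (auto simp: supp_pos_def)
  qed
  show "k m = card {j. Poly_Mapping.lookup (choice_exp k A) j = m}" if "m > 0" for m
  proof (cases "m \<in> S")
    case True
    then show ?thesis
      using eq A'(2) by (simp add: S_def)
  next
    case False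
    then have "{j. Poly_Mapping.lookup (choice_exp k A) j = m} = {}"
      using preimage that by blast
    then show ?thesis
      using False that by (simp add: S_def supp_pos_def)
  qed
qed

text \<open>Pairwise disjoint blocks of variables, so that \<open>b_exp k\<close> has exactly \<open>k m\<close> exponents equal to \<open>m\<close>.\<close>

definition disjoint_choice :: "(nat \<Rightarrow> nat) \<Rightarrow> nat \<Rightarrow> nat set" where
  "disjoint_choice k = (\<lambda>m\<in>supp_pos k. prod_encode ` ({m} \<times> {..<k m}))"

definition b_vars :: "(nat \<Rightarrow> nat) \<Rightarrow> nat set" where
  "b_vars k = (\<Union>m\<in>supp_pos k. disjoint_choice k m)"

definition b_exp :: "(nat \<Rightarrow> nat) \<Rightarrow> (nat \<Rightarrow>\<^sub>0 nat)" where
  "b_exp k = choice_exp k (disjoint_choice k)"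

lemma finite_disjoint_choice: "m \<in> supp_pos k \<Longrightarrow> finite (disjoint_choice k m)"
  by (simp add: disjoint_choice_def)

lemma finite_b_vars: "finite (supp_pos k) \<Longrightarrow> finite (b_vars k)"
  by (simp add: b_vars_def finite_disjoint_choice)

lemma card_disjoint_choice: "m \<in> supp_pos k \<Longrightarrow> card (disjoint_choice k m) = k m"
  using card_image[OF inj_prod_encode, of "{m} \<times> {..<k m}"] by (simp add: disjoint_choice_def)

lemma disjoint_choice_mem: "disjoint_choice k \<in> part_choices (b_vars k) k"
  unfolding part_choices_def
proof (rule PiE_I)
  show "disjoint_choice k m \<in> {A. A \<subseteq> b_vars k \<and> card A = k m}" if "m \<in> supp_pos k" for m
    using that card_disjoint_choice by (auto simp: b_vars_def)
qed (simp add: disjoint_choice_def)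

lemma card_keys_b_exp:
  assumes "finite (supp_pos k)"
  shows "card (Poly_Mapping.keys (b_exp k)) = num_parts k"
proof -
  have "card (Poly_Mapping.keys (b_exp k)) = card (\<Union>m\<in>supp_pos k. disjoint_choice k m)"
    unfolding b_exp_def using assms by (simp add: keys_choice_exp finite_disjoint_choice)
  also have "\<dots> = (\<Sum>m\<in>supp_pos k. card (disjoint_choice k m))"
    using assms by (intro card_UN_disjoint) (auto simp: finite_disjoint_choice, auto simp: disjoint_choice_def)
  finally show ?thesis
    by (simp add: num_parts_def card_disjoint_choice)
qed

text \<open>\<open>b_exp k\<close> involves exactly \<open>num_parts k\<close> variables, so by
  \<open>choice_exp_determines\<close> the disjoint choice is the only one producing it.\<close>

lemma lookup_psum_b_prod_self:
  assumes k: "finite (supp_pos k)"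
  shows "Poly_Mapping.lookup (psum (b_vars k) (b_prod k)) (b_exp k) = 1"
proof -
  let ?D = "disjoint_choice k"
  have "A = ?D" if A: "A \<in> part_choices (b_vars k) k" "choice_exp k A = b_exp k" for A
  proof (rule PiE_ext)
    show "A \<in> (\<Pi>\<^sub>E m\<in>supp_pos k. {A. A \<subseteq> b_vars k \<and> card A = k m})"
      "?D \<in> (\<Pi>\<^sub>E m\<in>supp_pos k. {A. A \<subseteq> b_vars k \<and> card A = k m})"
      using A(1) disjoint_choice_mem by (simp_all add: part_choices_def)
    fix m assume m: "m \<in> supp_pos k"
    show "A m = ?D m"
      using choice_exp_determines(1)[OF k finite_b_vars[OF k] A(1) _ m]
        choice_exp_determines(1)[OF k finite_b_vars[OF k] disjoint_choice_mem _ m]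
        card_keys_b_exp[OF k] A(2) unfolding b_exp_def by simp
  qed
  then have "choice_exp k A = b_exp k \<longleftrightarrow> A = ?D" if "A \<in> part_choices (b_vars k) k" for A
    using that by (auto simp: b_exp_def)
  then have "Poly_Mapping.lookup (psum (b_vars k) (b_prod k)) (b_exp k) =
      (\<Sum>A\<in>part_choices (b_vars k) k. if A = ?D then 1 else 0)"
    unfolding psum_b_prod[OF finite_b_vars[OF k] k] lookup_sum
    by (intro sum.cong refl) (simp add: lookup_single when_def)
  then show ?thesis
    using disjoint_choice_mem k by (simp add: finite_part_choices finite_b_vars)
qed

text \<open>Some choice for \<open>k'\<close> produces \<open>b_exp k\<close>, which has
  \<open>num_parts k\<close> variables. If \<open>k'\<close> has no more parts than that, the choice
  cannot overlap, and both functions are read off the same exponents. Agreement is required only for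
  positive \<open>m\<close>, the value at 0 being disregarded.\<close>

lemma lookup_psum_b_prod_neq_0:
  assumes k: "finite (supp_pos k)" and k': "finite (supp_pos k')"
    and neq: "Poly_Mapping.lookup (psum (b_vars k) (b_prod k')) (b_exp k) \<noteq> 0"
  shows "num_parts k < num_parts k' \<or> (\<forall>m>0. k m = k' m)"
proof -
  have "\<exists>A\<in>part_choices (b_vars k) k'. choice_exp k' A = b_exp k"
  proof (rule ccontr)
    assume "\<not> ?thesis"
    then have "Poly_Mapping.lookup (psum (b_vars k) (b_prod k')) (b_exp k) = 0"
      unfolding psum_b_prod[OF finite_b_vars[OF k] k'] lookup_sum
      by (intro sum.neutral) (auto simp: lookup_single when_def)
    with neq show False by contradiction
  qed
  then obtain A where A: "A \<in> part_choices (b_vars k) k'" "choice_exp k' A = b_exp k"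
    by blast
  show ?thesis
  proof (cases "num_parts k' \<le> num_parts k")
    case True
    have "k m = k' m" if "m > 0" for m
      using choice_exp_determines(2)[OF k' finite_b_vars[OF k] A(1) _ that]
        choice_exp_determines(2)[OF k finite_b_vars[OF k] disjoint_choice_mem _ that]
        card_keys_b_exp[OF k] A(2) True unfolding b_exp_def by simp
    then show ?thesis by blast
  qed auto
qed

section \<open>Integrality of coefficients and independence of \<open>B_lam\<close>\<close>

lemma b_prod_cong: "(\<And>m. m > 0 \<Longrightarrow> k m = k' m) \<Longrightarrow> b_prod k = b_prod k'"
  unfolding b_prod_def supp_pos_def by (intro prod.cong) auto

lemma B_lam_subset_sym_integral: "B_lam \<subseteq> sym_integral"
  by (auto simp: B_lam_def b_prod_def supp_pos_def intro!: sym_integral_prod sym_integral_lam_hhat)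

text \<open>The triangular system is indexed by elements of \<open>B_lam\<close>, each with a chosen
  representing function \<open>k v\<close>, and ranked by the number of parts.\<close>

lemma B_lam_coeffs_Ints:
  assumes T: "finite T" "T \<subseteq> B_lam"
    and p: "(\<Sum>v\<in>T. const (c v) * v) \<in> sym_integral"
    and v: "v \<in> T"
  shows "c v \<in> \<int>"
proof -
  have "\<forall>v\<in>T. \<exists>k. finite (supp_pos k) \<and> v = b_prod k"
    using T(2) by (auto simp: B_lam_def)
  then obtain k where k: "\<And>v. v \<in> T \<Longrightarrow> finite (supp_pos (k v))" "\<And>v. v \<in> T \<Longrightarrow> b_prod (k v) = v"
    by metis
  show ?thesis
  proof (rule sym_integral_triangular[where g = "\<lambda>v. v" and r = "num_parts \<circ> k" and X = "b_vars \<circ> k"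
        and \<tau> = "b_exp \<circ> k", OF T(1) refl p _ _ _ _ v])
    fix v assume v: "v \<in> T"
    show "v \<in> sym_integral"
      using v T(2) B_lam_subset_sym_integral by blast
    show "finite ((b_vars \<circ> k) v)"
      using k(1)[OF v] by (simp add: finite_b_vars)
    show "Poly_Mapping.lookup (psum ((b_vars \<circ> k) v) v) ((b_exp \<circ> k) v) = 1"
      using lookup_psum_b_prod_self[OF k(1)[OF v]] k(2)[OF v] by simp
    fix w assume w: "w \<in> T" "v \<noteq> w" "Poly_Mapping.lookup (psum ((b_vars \<circ> k) v) w) ((b_exp \<circ> k) v) \<noteq> 0"
    \<comment> \<open>Functions agreeing at all positive arguments represent the same element, so
      only the alternative with more parts remains.\<close>
    have "\<not> (\<forall>m>0. k v m = k w m)"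
      using w(2) b_prod_cong[of "k v" "k w"] k(2)[OF v] k(2)[OF w(1)] by auto
    moreover have "Poly_Mapping.lookup (psum (b_vars (k v)) (b_prod (k w))) (b_exp (k v)) \<noteq> 0"
      using w(3) k(2)[OF w(1)] by simp
    ultimately show "(num_parts \<circ> k) v < (num_parts \<circ> k) w"
      using lookup_psum_b_prod_neq_0[OF k(1)[OF v] k(1)[OF w(1)]] by auto
  qed
qed

text \<open>The zero combination may be divided by any integer, so its coefficients are divisible by
  every positive integer.\<close>

lemma B_lam_independent: "\<not> z_dependent B_lam"
  unfolding zmod.independent_explicit_module
proof (intro allI impI)
  fix T u v assume T: "finite T" "T \<subseteq> B_lam" and zero: "(\<Sum>v\<in>T. of_int (u v) * v) = 0" and v: "v \<in> T"
  \<comment> \<open>\<open>M\<close> exceeds the absolute value of \<open>u v\<close>, so it divides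
    \<open>u v\<close> only if \<open>u v = 0\<close>.\<close>
  define M where "M = \<bar>u v\<bar> + 1"
  have "(\<Sum>v\<in>T. const (of_int (u v) / of_int M) * v) = const (1 / of_int M) * (\<Sum>v\<in>T. of_int (u v) * v)"
    unfolding sum_distrib_left by (intro sum.cong refl) (simp flip: const_of_int const_mult mult.assoc)
  also have "\<dots> \<in> sym_integral"
    using sym_integral_of_int[of 0] by (simp add: zero)
  finally have "of_int (u v) / of_int M \<in> (\<int> :: rat set)"
    by (rule B_lam_coeffs_Ints[OF T _ v])
  then obtain z where "of_int (u v) / of_int M = (of_int z :: rat)"
    by (rule Ints_cases)
  then have "(of_int (u v) :: rat) = of_int (z * M)"
    by (simp add: M_def field_simps)
  then have "u v = z * M"
    by (simp only: of_int_eq_iff)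
  then have "M dvd u v"
    by simp
  then show "u v = 0"
    using zdvd_not_zless[of "\<bar>u v\<bar>" M] by (auto simp: M_def)
qed

section \<open>Spanning over the rationals by total degree\<close>

text \<open>Every h_r has degree 1 here, not r, so that h_m^k / k! is the top-degree part of
  \<open>lam m (hhat k)\<close>.\<close>

definition mdeg :: "(nat \<Rightarrow>\<^sub>0 nat) \<Rightarrow> nat" where
  "mdeg t = (\<Sum>i\<in>Poly_Mapping.keys t. Poly_Mapping.lookup t i)"

lemma mdeg_add: "mdeg (s + t) = mdeg s + mdeg t"
  unfolding mdeg_def by (rule setsum_keys_plus_distrib) auto

definition deg_less :: "nat \<Rightarrow> hpoly \<Rightarrow> bool" where
  "deg_less n p \<longleftrightarrow> (\<forall>t\<in>Poly_Mapping.keys p. mdeg t < n)"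

lemma deg_less_0 [simp]: "deg_less n 0"
  by (simp add: deg_less_def)

lemma deg_less_mono: "deg_less m p \<Longrightarrow> m \<le> n \<Longrightarrow> deg_less n p"
  by (auto simp: deg_less_def)

lemma deg_less_add: "deg_less n p \<Longrightarrow> deg_less n q \<Longrightarrow> deg_less n (p + q)"
  using keys_add[of p q] by (auto simp: deg_less_def)

lemma deg_less_sum: "(\<And>x. x \<in> A \<Longrightarrow> deg_less n (f x)) \<Longrightarrow> deg_less n (sum f A)"
  by (induction A rule: infinite_finite_induct) (simp_all add: deg_less_add)

lemma deg_less_mult: "deg_less (Suc m) p \<Longrightarrow> deg_less n q \<Longrightarrow> deg_less (m + n) (p * q)"
  using keys_mult[of p q] by (fastforce simp: deg_less_def mdeg_add)

lemma deg_less_const: "deg_less (Suc 0) (const c)"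
  by (simp add: deg_less_def const_def mdeg_def)

lemma deg_less_const_mult: "deg_less n p \<Longrightarrow> deg_less n (const c * p)"
  using deg_less_mult[OF deg_less_const] by simp

lemma deg_less_hgen: "deg_less (Suc 1) (hgen r)"
  by (simp add: deg_less_def hgen_def mdeg_def)

text \<open>Both elements have degree at most \<open>n\<close> and share their component of degree
  \<open>n\<close>; for \<open>n = 0\<close> they are equal.\<close>

definition deg_approx :: "nat \<Rightarrow> hpoly \<Rightarrow> hpoly \<Rightarrow> bool" where
  "deg_approx n p q \<longleftrightarrow> deg_less n (p - q) \<and> deg_less (Suc n) q"

lemma deg_approx_deg_less: "deg_approx n p q \<Longrightarrow> deg_less (Suc n) p"
  using deg_less_add[of "Suc n" "p - q" q] deg_less_mono[of n "p - q" "Suc n"] by (simp add: deg_approx_def)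

lemma deg_approx_mult:
  assumes "deg_approx m p p'" "deg_approx n q q'"
  shows "deg_approx (m + n) (p * q) (p' * q')"
proof -
  have "p * q - p' * q' = p' * (q - q') + q * (p - p')"
    by (simp add: algebra_simps)
  then show ?thesis
    using assms deg_approx_deg_less[OF assms(2)]
      deg_less_mult[of m p' n "q - q'"] deg_less_mult[of n q m "p - p'"] deg_less_mult[of m p' "Suc n" q']
    by (simp add: deg_approx_def deg_less_add add.commute)
qed

lemma deg_approx_1: "deg_approx 0 1 1"
  using deg_less_const[of 1] by (simp add: deg_approx_def)

lemma deg_approx_prod:
  "(\<And>x. x \<in> A \<Longrightarrow> deg_approx (n x) (f x) (g x)) \<Longrightarrow> deg_approx (sum n A) (prod f A) (prod g A)"
  by (induction A rule: infinite_finite_induct) (simp_all add: deg_approx_1 deg_approx_mult)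

lemma deg_approx_const_mult:
  "deg_approx n p q \<Longrightarrow> deg_approx n (const c * p) (const c * q)"
  by (simp add: deg_approx_def deg_less_const_mult flip: right_diff_distrib)

lemma deg_approx_add:
  assumes "deg_approx n p q" "deg_less n r"
  shows "deg_approx n (p + r) q"
  using deg_less_add[of n "p - q" r] assms by (simp add: deg_approx_def add_diff_eq diff_add_eq)

lemma lam_newton:
  "of_nat (Suc k) * lam m (hhat (Suc k)) = (\<Sum>i\<le>k. (-1) ^ i * hgen (m * Suc i) * lam m (hhat (k - i)))"
proof -
  have sgn: "lam m ((-1) ^ i) = (-1) ^ i" for i
    using hsubst_of_int[of _ "(-1) ^ i"] by (simp add: lam_def)
  have "of_nat (Suc k) * lam m (hhat (Suc k)) = lam m (of_nat (Suc k) * hhat (Suc k))"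
    unfolding lam_mult by (simp only: lam_def hsubst_of_nat)
  also have "\<dots> = (\<Sum>i\<le>k. lam m ((-1) ^ i * hgen (Suc i) * hhat (k - i)))"
    unfolding hhat_newton unfolding lam_def by (rule hsubst_sum)
  finally show ?thesis
    by (simp only: lam_mult sgn lam_h zero_less_Suc)
qed

text \<open>In Newton's identity only the term \<open>i = 0\<close> reaches the top degree, so up to
  lower degree each step multiplies by \<open>hgen m\<close> and divides by the new index.\<close>

lemma deg_approx_lam_hhat:
  assumes "m > 0"
  shows "deg_approx k (lam m (hhat k)) (const (1 / fact k) * hgen m ^ k)"
proof (induction k rule: less_induct)
  case (less k)
  show ?case
  proof (cases k)
    case 0
    then show ?thesis
      using lam_hhat_0[of m] by (simp add: deg_approx_1)
  next
    case (Suc l)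
    let ?a = "\<lambda>i. lam m (hhat i)"
    have "deg_approx 1 (hgen m) (hgen m)"
      using deg_less_hgen by (simp add: deg_approx_def)
    then have "deg_approx (1 + l) (hgen m * ?a l) (hgen m * (const (1 / fact l) * hgen m ^ l))"
      using less Suc by (intro deg_approx_mult) simp_all
    \<comment> \<open>These are the remaining terms, with index shifted by one: a generator times an
      element of degree at most \<open>l - Suc i\<close> has degree at most
      \<open>l\<close>.\<close>
    moreover have "deg_less (1 + l) (\<Sum>i<l. (-1) ^ Suc i * hgen (m * Suc (Suc i)) * ?a (l - Suc i))"
    proof (rule deg_less_sum)
      fix i assume i: "i \<in> {..<l}"
      have "deg_less (Suc (l - Suc i)) (?a (l - Suc i))"
        using Suc by (intro deg_approx_deg_less[OF less]) simp
      then have "deg_less (1 + Suc (l - Suc i)) (const ((-1) ^ Suc i) * (hgen (m * Suc (Suc i)) * ?a (l - Suc i)))"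
        by (intro deg_less_const_mult deg_less_mult deg_less_hgen)
      moreover have "const ((-1) ^ Suc i) = (-1) ^ Suc i"
        using const_of_int[of "(-1) ^ Suc i"] by simp
      ultimately show "deg_less (1 + l) ((-1) ^ Suc i * hgen (m * Suc (Suc i)) * ?a (l - Suc i))"
        using i by (simp only: mult.assoc) (erule deg_less_mono, auto)
    qed
    ultimately have "deg_approx (1 + l)
        (hgen m * ?a l + (\<Sum>i<l. (-1) ^ Suc i * hgen (m * Suc (Suc i)) * ?a (l - Suc i)))
        (hgen m * (const (1 / fact l) * hgen m ^ l))"
      by (rule deg_approx_add)
    also have "hgen m * ?a l + (\<Sum>i<l. (-1) ^ Suc i * hgen (m * Suc (Suc i)) * ?a (l - Suc i)) =
        of_nat (Suc l) * ?a (Suc l)"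
      unfolding lam_newton lessThan_Suc_atMost[symmetric] sum.lessThan_Suc_shift by simp
    finally have "deg_approx (1 + l) (const (1 / of_nat (Suc l)) * (of_nat (Suc l) * ?a (Suc l)))
        (const (1 / of_nat (Suc l)) * (hgen m * (const (1 / fact l) * hgen m ^ l)))"
      by (rule deg_approx_const_mult)
    moreover have "const (1 / of_nat (Suc l)) * (of_nat (Suc l) * ?a (Suc l)) = ?a (Suc l)"
      by (simp del: of_nat_Suc flip: mult.assoc const_of_nat const_mult)
    moreover have "const (1 / of_nat (Suc l)) * (hgen m * (const (1 / fact l) * hgen m ^ l)) =
        const (1 / of_nat (Suc l) * (1 / fact l)) * hgen m ^ Suc l"
      unfolding const_mult by (simp add: algebra_simps)
    moreover have "1 / of_nat (Suc l) * (1 / fact l) = (1 / fact (Suc l) :: rat)"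
      by simp
    ultimately show ?thesis
      by (simp only: Suc plus_1_eq_Suc)
  qed
qed

interpretation qmod: module "\<lambda>(c::rat) (x::hpoly). const c * x"
  by unfold_locales (simp_all add: algebra_simps const_add const_mult)

text \<open>The top-degree part of a suitable \<open>b_prod k\<close> is a nonzero rational multiple
  of \<open>xmon t\<close>; the remainder consists of monomials of smaller degree, covered by
  induction.\<close>

lemma xmon_in_qspan_B_lam: "xmon t \<in> qmod.span B_lam"
proof (induction "mdeg t" arbitrary: t rule: less_induct)
  case less
  \<comment> \<open>\<open>k m\<close> is the exponent of h_m in \<open>xmon t\<close>; the shift
    reflects that h_m is variable number \<open>m - 1\<close>.\<close>
  define k where "k m = (if m = 0 then 0 else Poly_Mapping.lookup t (m - 1))" for m
  define a where "a = (\<Prod>i\<in>Poly_Mapping.keys t. 1 / fact (k (Suc i)) :: rat)"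
  have supp: "supp_pos k = Suc ` Poly_Mapping.keys t"
  proof (intro set_eqI)
    show "m \<in> supp_pos k \<longleftrightarrow> m \<in> Suc ` Poly_Mapping.keys t" for m
      by (cases m) (auto simp: supp_pos_def k_def in_keys_iff)
  qed
  have "deg_approx (\<Sum>m\<in>supp_pos k. k m) (b_prod k) (\<Prod>m\<in>supp_pos k. const (1 / fact (k m)) * hgen m ^ k m)"
    unfolding b_prod_def by (intro deg_approx_prod deg_approx_lam_hhat) (simp add: supp_pos_def)
  also have "(\<Sum>m\<in>supp_pos k. k m) = mdeg t"
    by (simp add: supp sum.reindex mdeg_def k_def)
  also have "(\<Prod>m\<in>supp_pos k. const (1 / fact (k m)) * hgen m ^ k m) =
      (\<Prod>i\<in>Poly_Mapping.keys t. const (1 / fact (k (Suc i)))) * xmon t"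
    by (simp add: supp prod.reindex prod.distrib flip: xmon_hgen) (simp add: k_def)
  also have "(\<Prod>i\<in>Poly_Mapping.keys t. const (1 / fact (k (Suc i)))) = const a"
  proof -
    have "(\<Prod>i\<in>A. const (f i)) = const (\<Prod>i\<in>A. f i)" for f and A :: "nat set"
      by (induction A rule: infinite_finite_induct) (simp_all add: const_mult)
    then show ?thesis
      by (simp only: a_def)
  qed
  finally have "deg_less (mdeg t) (b_prod k - const a * xmon t)"
    by (simp add: deg_approx_def)
  then have lower: "xmon s \<in> qmod.span B_lam" if "s \<in> Poly_Mapping.keys (b_prod k - const a * xmon t)" for s
    using that less by (auto simp: deg_less_def)
  define d where "d = b_prod k - const a * xmon t"
  have "d = (\<Sum>s\<in>Poly_Mapping.keys d. const (Poly_Mapping.lookup d s) * xmon s)"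
    by (rule sum_const_mult_xmon[symmetric])
  also have "\<dots> \<in> qmod.span B_lam"
    using lower by (intro qmod.span_sum qmod.span_scale) (simp add: d_def)
  finally have "d \<in> qmod.span B_lam" .
  moreover have "b_prod k \<in> B_lam"
    using supp by (auto simp: B_lam_def)
  ultimately have "b_prod k - d \<in> qmod.span B_lam"
    by (intro qmod.span_diff[OF qmod.span_base])
  then have "const a * xmon t \<in> qmod.span B_lam"
    by (simp add: d_def)
  then have "const (1 / a) * (const a * xmon t) \<in> qmod.span B_lam"
    by (rule qmod.span_scale)
  moreover have "a \<noteq> 0"
    by (simp add: a_def)
  then have "const (1 / a) * (const a * xmon t) = xmon t"
    by (simp flip: mult.assoc const_mult)
  ultimately show ?case
    by (simp only:)
qed

lemma qspan_B_lam: "p \<in> qmod.span B_lam"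
proof -
  have "p = (\<Sum>s\<in>Poly_Mapping.keys p. const (Poly_Mapping.lookup p s) * xmon s)"
    by (rule sum_const_mult_xmon[symmetric])
  also have "\<dots> \<in> qmod.span B_lam"
    by (intro qmod.span_sum qmod.span_scale xmon_in_qspan_B_lam)
  finally show ?thesis .
qed

section \<open>Integer span of \<open>B_lam\<close> and conclusion\<close>

text \<open>Rational spanning supplies coefficients for each element of \<open>sym_integral\<close>,
  and \<open>B_lam_coeffs_Ints\<close> makes them integers.\<close>

lemma z_span_B_lam: "z_span B_lam = sym_integral"
proof
  show "z_span B_lam \<subseteq> sym_integral"
    using B_lam_subset_sym_integral z_subalgebra_sym_integral
    by (intro zmod.span_minimal) (simp_all add: z_subalgebra_def)
  show "sym_integral \<subseteq> z_span B_lam"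
  proof
    fix p assume p: "p \<in> sym_integral"
    obtain T c where T: "finite T" "T \<subseteq> B_lam" and pT: "p = (\<Sum>v\<in>T. const (c v) * v)"
      using qspan_B_lam[of p] by (auto simp: qmod.span_explicit)
    have "p \<in> z_span ((\<lambda>v. v) ` T)"
      using p unfolding pT by (intro sum_const_Ints_in_z_span) (rule B_lam_coeffs_Ints[OF T])
    then show "p \<in> z_span B_lam"
      using zmod.span_mono[OF T(2)] by auto
  qed
qed

theorem theoremB11:
  shows "z_basis_of B_lam Z_hhat \<and> Z_hhat = Z_lam"
  unfolding z_basis_of_def Z_lam_def Z_hhat_eq_sym_integral z_span_B_lam
  using B_lam_subset_sym_integral B_lam_independent by blast

end
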